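(* Let $0<q<1$, $w\ge1$, $m\in\mathbb{N}_0$, and for $i=1,\dots,w$ let $n_i\in\mathbb{N}_0$ with $n_i\ge m$, and $x_i\in[0,1]$. Then \[ \prod_{i=1}^{w}\frac{1}{([1-x_i]_q+[x_i]_q)^{n_i-m}}\sum_{k_1=m}^{n_1}\cdots\sum_{k_w=m}^{n_w}\Big(\prod_{i=1}^{w}\frac{\binom{k_i}{m}}{\binom{n_i}{m}}\Big)B_{k_1,\dots,k_w;n_1,\dots,n_w}(x_1,\dots,x_w;q) =\sum_{l_1=0}^{m}\cdots\sum_{l_w=0}^{m}q^{\sum_{i=1}^{w}\binom{l_i}{2}}\prod_{i=1}^{w}\binom{x_i}{l_i}_q[l_i]_q!\,S(m,l_i;q). \]
   Context: For $0<q<1$ and real $x$, $[x]_q=\frac{1-q^x}{1-q}$; $[0]_q!=1$ and $[k]_q!=[k]_q[k-1]_q\cdots[1]_q$; for real $x$ and $k\in\mathbb{N}_0$, $\binom{x}{k}_q=\frac{[x]_q[x-1]_q\cdots[x-k+1]_q}{[k]_q!}$ (equal to $1$ for $k=0$). For $x_i\in[0,1]$ and $0\le k_i\le n_i$, $B_{k_1,\dots,k_w;n_1,\dots,n_w}(x_1,\dots,x_w;q)=\prod_{i=1}^w\binom{n_i}{k_i}[x_i]_q^{k_i}[1-x_i]_q^{n_i-k_i}$. The $q$-Stirling numbers of the second kind are $S(n,k;q)=\frac{q^{-\binom{k}{2}}}{[k]_q!}\sum_{j=0}^{k}(-1)^j q^{\binom{j}{2}}\binom{k}{j}_q[k-j]_q^{\,n}$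 (with $0^0=1$). *)

theory Defs
  imports Complex_Main "HOL-Library.FuncSet"
begin

definition qnum :: "real \<Rightarrow> real \<Rightarrow> real" where
  "qnum q x = (1 - q powr x) / (1 - q)"

definition qfact :: "real \<Rightarrow> nat \<Rightarrow> real" where
  "qfact q k = (\<Prod>j=1..k. qnum q (real j))"

definition qbinom :: "real \<Rightarrow> real \<Rightarrow> nat \<Rightarrow> real" where
  "qbinom q x k = (\<Prod>j<k. qnum q (x - real j)) / qfact q k"

text \<open>
  Multi-indices \<open>k\<^sub>1,\<dots>,k\<^sub>w\<close> and points \<open>x\<^sub>1,\<dots>,x\<^sub>w\<close> are functions on \<open>nat\<close>, of which only
  the values on \<open>{1..w}\<close> are used. The binomial coefficients in the Bernstein polynomials
  are the ordinary ones.
\<close>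

definition qbernstein ::
  "nat \<Rightarrow> (nat \<Rightarrow> nat) \<Rightarrow> (nat \<Rightarrow> nat) \<Rightarrow> (nat \<Rightarrow> real) \<Rightarrow> real \<Rightarrow> real" where
  "qbernstein w k n x q =
     (\<Prod>i=1..w. real (n i choose k i) * qnum q (x i) ^ k i * qnum q (1 - x i) ^ (n i - k i))"

text \<open>
  In the \<open>q\<close>-Stirling numbers of the second kind, the summand \<open>j = k\<close> for \<open>n = 0\<close> relies on
  \<open>0 ^ 0 = 1\<close>.
\<close>

definition qstirling2 :: "nat \<Rightarrow> nat \<Rightarrow> real \<Rightarrow> real" where
  "qstirling2 n k q = q powi (- int (k choose 2)) / qfact q k *
     (\<Sum>j=0..k. (-1) ^ j * q ^ (j choose 2) * qbinom q (real k) j * qnum q (real k - real j) ^ n)"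

end

theory Submission
  imports Defs
begin

text \<open>
  Both sides factor over the coordinates, and each coordinate contributes \<open>[x\<^sub>i]\<^sub>q ^ m\<close>. On the
  left this is the binomial theorem, after \<open>(n choose k) (k choose m)\<close> is rewritten as
  \<open>(n choose m) (n - m choose k - m)\<close>. On the right it is the expansion of a power of \<open>[x]\<^sub>q\<close>
  in falling \<open>q\<close>-factorials, which follows from \<open>[x]\<^sub>q = [k]\<^sub>q + q\<^sup>k [x - k]\<^sub>q\<close> and the recurrence
  \<open>S(m + 1, k) = S(m, k - 1) + [k]\<^sub>q S(m, k)\<close>.
\<close>

section \<open>\<open>q\<close>-numbers, \<open>q\<close>-factorials and \<open>q\<close>-binomial
  coefficients\<close>

lemma qnum_0 [simp]: "0 < q \<Longrightarrow> qnum q 0 = 0"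
  by (simp add: qnum_def)

lemma qnum_pos:
  assumes "0 < q" "q < 1" "x > 0"
  shows "qnum q x > 0"
  using assms powr_less_mono'[of q 0 x] by (simp add: qnum_def)

lemma qnum_nonneg:
  assumes "0 < q" "q < 1" "x \<ge> 0"
  shows "qnum q x \<ge> 0"
  using assms qnum_pos[of q x] by (cases "x = 0") auto

text \<open>Holds because \<open>1 - q powr x\<close> splits at \<open>q ^ k\<close>. It is behind
  the Pascal rule, the Stirling recurrence and the expansion of powers of
  \<open>qnum q x\<close>.\<close>

lemma qnum_shift:
  assumes "0 < q" "q < 1"
  shows "qnum q x = qnum q (real k) + q ^ k * qnum q (x - real k)"
proof -
  have "q ^ k * q powr (x - real k) = q powr x"
    using assms by (simp add: powr_diff powr_realpow)
  then have eq: "1 - q powr x = (1 - q ^ k) + q ^ k * (1 - q powr (x - real k))"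
    by (simp add: algebra_simps)
  show ?thesis
    using assms unfolding qnum_def eq by (simp add: powr_realpow add_divide_distrib)
qed

lemma qfact_0 [simp]: "qfact q 0 = 1"
  by (simp add: qfact_def)

lemma qfact_Suc: "qfact q (Suc k) = qnum q (real (Suc k)) * qfact q k"
  by (simp add: qfact_def mult.commute)

lemma qfact_pos:
  assumes "0 < q" "q < 1"
  shows "qfact q k > 0"
  unfolding qfact_def using assms by (intro prod_pos) (auto intro: qnum_pos)

lemma qbinom_0 [simp]: "qbinom q x 0 = 1"
  by (simp add: qbinom_def)

text \<open>Absorption that peels off the first factor of the falling product, so \<open>x\<close>
  drops by one; the primed version peels off the last factor and keeps \<open>x\<close>.\<close>

lemma qbinom_Suc_times:
  assumes "0 < q" "q < 1"
  shows "qbinom q x (Suc k) * qnum q (real (Suc k)) = qnum q x * qbinom q (x - 1) k"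
proof -
  have "(\<Prod>j<Suc k. qnum q (x - real j)) = qnum q x * (\<Prod>j<k. qnum q (x - 1 - real j))"
    by (subst prod.lessThan_Suc_shift) (simp add: algebra_simps)
  then show ?thesis
    using qnum_pos[OF assms, of "real (Suc k)"] qfact_pos[OF assms, of k]
    unfolding qbinom_def qfact_Suc by (simp add: field_simps del: of_nat_Suc)
qed

lemma qbinom_Suc_times':
  assumes "0 < q" "q < 1"
  shows "qbinom q x (Suc k) * qnum q (real (Suc k)) = qnum q (x - real k) * qbinom q x k"
  using qnum_pos[OF assms, of "real (Suc k)"] qfact_pos[OF assms, of k]
  unfolding qbinom_def qfact_Suc by (simp add: field_simps del: of_nat_Suc)

lemma qbinom_pascal:
  assumes "0 < q" "q < 1"
  shows "qbinom q x (Suc k) = qbinom q (x - 1) k + q ^ Suc k * qbinom q (x - 1) (Suc k)"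
proof -
  let ?c = "qnum q (real (Suc k))"
  \<comment> \<open>Split \<open>qnum q x\<close> at \<open>Suc k\<close>: the two summands become,
    after absorption, the two terms of the Pascal rule.\<close>
  have "qbinom q x (Suc k) * ?c = (?c + q ^ Suc k * qnum q (x - real (Suc k))) * qbinom q (x - 1) k"
    using qbinom_Suc_times[OF assms, of x k] qnum_shift[OF assms, of x "Suc k"] by metis
  also have "\<dots> = ?c * qbinom q (x - 1) k + q ^ Suc k * (qnum q (x - 1 - real k) * qbinom q (x - 1) k)"
    by (simp add: algebra_simps)
  also have "\<dots> = (qbinom q (x - 1) k + q ^ Suc k * qbinom q (x - 1) (Suc k)) * ?c"
    unfolding qbinom_Suc_times'[OF assms, symmetric] by (simp only: algebra_simps)
  finally show ?thesis
    using qnum_pos[OF assms, of "real (Suc k)"] by (simp del: of_nat_Suc)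
qed

lemma qbinom_eq_0:
  assumes "0 < q" "k < l"
  shows "qbinom q (real k) l = 0"
proof -
  have "(\<Prod>j<l. qnum q (real k - real j)) = 0"
    using assms by (intro prod_zero) (auto intro!: bexI[of _ k])
  then show ?thesis by (simp add: qbinom_def)
qed

lemma choose_Suc_two: "Suc k choose 2 = (k choose 2) + k"
  by (simp add: numeral_2_eq_2)

text \<open>The Pascal rule makes the sum telescope. Keeping \<open>x\<close> real and independent
  of \<open>k\<close> is what allows induction on the upper limit.\<close>

lemma alternating_qbinom_partial_sum:
  assumes "0 < q" "q < 1"
  shows "(\<Sum>j\<le>k. (-1) ^ j * q ^ (j choose 2) * qbinom q x j)
    = (-1) ^ k * q ^ (Suc k choose 2) * qbinom q (x - 1) k"
proof (induction k)
  case 0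
  show ?case by (simp add: choose_Suc_two)
next
  case (Suc k)
  then show ?case
    by (simp add: qbinom_pascal[OF assms, of x] choose_Suc_two power_add algebra_simps)
qed

text \<open>At \<open>x = Suc k\<close> the closed form of the full sum contains
  \<open>qbinom q (real k) (Suc k)\<close>, which has a zero factor.\<close>

lemma alternating_qbinom_sum_eq_0:
  assumes "0 < q" "q < 1"
  shows "(\<Sum>j\<le>Suc k. (-1) ^ j * q ^ (j choose 2) * qbinom q (real (Suc k)) j) = 0"
  unfolding alternating_qbinom_partial_sum[OF assms] using assms by (simp add: qbinom_eq_0)

section \<open>\<open>q\<close>-Stirling numbers of the second kind and powers of
  \<open>q\<close>-numbers\<close>

lemma qstirling2_eq:
  "qstirling2 n k q = (\<Sum>j\<le>k. (-1) ^ j * q ^ (j choose 2) * qbinom q (real k) j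
     * qnum q (real k - real j) ^ n) / (q ^ (k choose 2) * qfact q k)"
  by (simp add: qstirling2_def atLeast0AtMost power_int_minus field_simps)

lemma qstirling2_0_0: "qstirling2 0 0 q = 1"
  by (simp add: qstirling2_eq numeral_2_eq_2)

lemma qstirling2_0_Suc:
  assumes "0 < q" "q < 1"
  shows "qstirling2 0 (Suc k) q = 0"
  using alternating_qbinom_sum_eq_0[OF assms, of k] by (simp add: qstirling2_eq)

lemma qstirling2_Suc_0: "0 < q \<Longrightarrow> qstirling2 (Suc n) 0 q = 0"
  by (simp add: qstirling2_eq)

text \<open>One factor \<open>qnum q (K - j)\<close> is written as
  \<open>qnum q K - q ^ (K - j) * qnum q j\<close>, where \<open>K = Suc k\<close>. The first part
  yields the term with \<open>S(n, K)\<close>; in the second, \<open>qnum q j\<close> is absorbed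
  into the \<open>q\<close>-binomial and the index shifts, which yields
  \<open>S(n, k)\<close>.\<close>

lemma qstirling2_Suc_Suc:
  assumes "0 < q" "q < 1"
  shows "qstirling2 (Suc n) (Suc k) q
    = qstirling2 n k q + qnum q (real (Suc k)) * qstirling2 n (Suc k) q"
proof -
  define K where "K = real (Suc k)"
  define c where "c j = (-1) ^ j * q ^ (j choose 2) * qbinom q K j * qnum q (K - real j) ^ n" for j
  define d where "d j = (-1) ^ j * q ^ (j choose 2) * qbinom q (real k) j * qnum q (real k - real j) ^ n"
    for j
  \<comment> \<open>The exponents of \<open>q\<close> add up to \<open>k + (j choose 2)\<close>, so
    the factor \<open>q ^ k\<close> is free of \<open>j\<close> and can leave the sum.\<close>
  have shift: "c (Suc j) * (q ^ (k - j) * qnum q (real (Suc j))) = - (qnum q K * q ^ k * d j)"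
    if "j \<le> k" for j
  proof -
    have "q ^ (Suc j choose 2) * q ^ (k - j) = q ^ k * q ^ (j choose 2)"
      using that by (simp add: choose_Suc_two add.commute flip: power_add)
    moreover have "qbinom q K (Suc j) * qnum q (real (Suc j)) = qnum q K * qbinom q (real k) j"
      using qbinom_Suc_times[OF assms, of K j] by (simp add: K_def)
    moreover have "K - real (Suc j) = real k - real j"
      by (simp add: K_def)
    moreover have "c (Suc j) * (q ^ (k - j) * qnum q (real (Suc j)))
        = (-1) ^ Suc j * (q ^ (Suc j choose 2) * q ^ (k - j))
          * (qbinom q K (Suc j) * qnum q (real (Suc j))) * qnum q (K - real (Suc j)) ^ n"
      unfolding c_def by (simp only: mult_ac)
    ultimately have "c (Suc j) * (q ^ (k - j) * qnum q (real (Suc j)))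
        = (-1) ^ Suc j * (q ^ k * q ^ (j choose 2)) * (qnum q K * qbinom q (real k) j)
          * qnum q (real k - real j) ^ n"
      by (simp only:)
    then show ?thesis by (simp add: d_def mult_ac)
  qed
  have qnum_diff: "qnum q (K - real j) = qnum q K - q ^ (Suc k - j) * qnum q (real j)"
    if "j \<le> Suc k" for j
    using qnum_shift[OF assms, of K "Suc k - j"] that by (simp add: K_def of_nat_diff algebra_simps)
  have "(\<Sum>j\<le>Suc k. c j * qnum q (K - real j))
      = (\<Sum>j\<le>Suc k. qnum q K * c j - c j * (q ^ (Suc k - j) * qnum q (real j)))"
    by (intro sum.cong refl) (simp add: qnum_diff algebra_simps)
  also have "\<dots> = qnum q K * (\<Sum>j\<le>Suc k. c j)
      - (\<Sum>j\<le>Suc k. c j * (q ^ (Suc k - j) * qnum q (real j)))"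
    by (simp add: sum_subtractf sum_distrib_left del: sum.atMost_Suc)
  \<comment> \<open>The term \<open>j = 0\<close> drops out because
    \<open>qnum q 0 = 0\<close>.\<close>
  also have "(\<Sum>j\<le>Suc k. c j * (q ^ (Suc k - j) * qnum q (real j)))
      = (\<Sum>j\<le>k. c (Suc j) * (q ^ (k - j) * qnum q (real (Suc j))))"
    using assms by (subst sum.atMost_Suc_shift) simp
  also have "\<dots> = - (qnum q K * q ^ k * (\<Sum>j\<le>k. d j))"
    by (simp add: shift sum_negf sum_distrib_left del: of_nat_Suc)
  finally have "(\<Sum>j\<le>Suc k. c j * qnum q (K - real j))
      = qnum q K * q ^ k * (\<Sum>j\<le>k. d j) + qnum q K * (\<Sum>j\<le>Suc k. c j)"
    by simp
  moreover have "qstirling2 (Suc n) (Suc k) q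
      = (\<Sum>j\<le>Suc k. c j * qnum q (K - real j)) / (q ^ (Suc k choose 2) * qfact q (Suc k))"
    unfolding qstirling2_eq c_def K_def by (simp only: power_Suc mult_ac)
  moreover have "qstirling2 n (Suc k) q = (\<Sum>j\<le>Suc k. c j) / (q ^ (Suc k choose 2) * qfact q (Suc k))"
    unfolding qstirling2_eq c_def K_def ..
  moreover have "qstirling2 n k q = (\<Sum>j\<le>k. d j) / (q ^ (k choose 2) * qfact q k)"
    unfolding qstirling2_eq d_def ..
  moreover have "qnum q K > 0"
    unfolding K_def using qnum_pos[OF assms] by simp
  \<comment> \<open>The factor \<open>qnum q K * q ^ k\<close> is exactly the quotient of the
    normalizing denominators for \<open>Suc k\<close> and \<open>k\<close>.\<close>
  ultimately show ?thesis
    using assms qfact_pos[OF assms, of k] unfolding K_def[symmetric] qfact_Suc choose_Suc_two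
    by (simp add: add_divide_distrib power_add del: sum.atMost_Suc)
qed

lemma qstirling2_eq_0:
  assumes "0 < q" "q < 1" "n < k"
  shows "qstirling2 n k q = 0"
  using assms(3)
proof (induction n arbitrary: k)
  case 0
  then show ?case using qstirling2_0_Suc[OF assms(1,2)] by (cases k) auto
next
  case (Suc n)
  then show ?case using qstirling2_Suc_Suc[OF assms(1,2)] by (cases k) auto
qed

lemma qnum_power_eq_sum_qstirling2:
  assumes "0 < q" "q < 1"
  shows "qnum q x ^ m
    = (\<Sum>l\<le>m. q ^ (l choose 2) * (qbinom q x l * qfact q l * qstirling2 m l q))"
proof -
  \<comment> \<open>With this power of \<open>q\<close>, \<open>a l\<close> is the product of
    \<open>qnum q x - qnum q i\<close> over \<open>i < l\<close>, which gives the classical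
    recurrence \<open>a_times\<close>.\<close>
  define a where "a l = q ^ (l choose 2) * (qbinom q x l * qfact q l)" for l
  have a_Suc: "a (Suc l) = a l * (q ^ l * qnum q (x - real l))" for l
  proof -
    have "qbinom q x (Suc l) * qfact q (Suc l) = qnum q (x - real l) * qbinom q x l * qfact q l"
      using qbinom_Suc_times'[OF assms, of x l] unfolding qfact_Suc by (metis mult.assoc)
    then show ?thesis by (simp add: a_def choose_Suc_two power_add)
  qed
  have a_times: "qnum q x * a l = a (Suc l) + qnum q (real l) * a l" for l
    using qnum_shift[OF assms, of x l] by (simp add: a_Suc algebra_simps)
  have "qnum q x ^ m = (\<Sum>l\<le>m. a l * qstirling2 m l q)"
  proof (induction m)
    case 0
    show ?case by (simp add: a_def qstirling2_0_0 numeral_2_eq_2)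
  next
    case (Suc m)
    let ?S = "\<lambda>l. qstirling2 m l q"
    have "qnum q x ^ Suc m = (\<Sum>l\<le>m. qnum q x * a l * ?S l)"
      by (simp add: Suc.IH sum_distrib_left mult.assoc)
    also have "\<dots> = (\<Sum>l\<le>m. a (Suc l) * ?S l) + (\<Sum>l\<le>m. qnum q (real l) * a l * ?S l)"
      by (simp add: a_times sum.distrib distrib_right)
    \<comment> \<open>The added term contains \<open>S(m, m + 1) = 0\<close>; the term
      \<open>l = 0\<close> then goes because \<open>qnum q 0 = 0\<close>, and both sums run over
      \<open>a (Suc l)\<close>.\<close>
    also have "(\<Sum>l\<le>m. qnum q (real l) * a l * ?S l) = (\<Sum>l\<le>Suc m. qnum q (real l) * a l * ?S l)"
      by (simp add: qstirling2_eq_0[OF assms])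
    also have "\<dots> = (\<Sum>l\<le>m. qnum q (real (Suc l)) * a (Suc l) * ?S (Suc l))"
      using assms by (subst sum.atMost_Suc_shift) simp
    also have "(\<Sum>l\<le>m. a (Suc l) * ?S l) + \<dots> = (\<Sum>l\<le>m. a (Suc l) * qstirling2 (Suc m) (Suc l) q)"
      by (simp only: qstirling2_Suc_Suc[OF assms] distrib_left sum.distrib mult_ac)
    \<comment> \<open>The restored term \<open>l = 0\<close> is zero since
      \<open>S(m + 1, 0) = 0\<close>.\<close>
    also have "\<dots> = (\<Sum>l\<le>Suc m. a l * qstirling2 (Suc m) l q)"
      using assms by (subst sum.atMost_Suc_shift) (simp add: qstirling2_Suc_0)
    finally show ?case .
  qed
  then show ?thesis by (simp add: a_def mult.assoc)
qed

text \<open>Over the reals this is the expansion of \<open>(a + b) ^ n\<close> differentiated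
  \<open>m\<close> times in \<open>a\<close> and scaled by \<open>a ^ m / m!\<close>; the algebraic
  proof works in any commutative semiring.\<close>

lemma binomial_sum_choose:
  fixes a b :: "'a :: comm_semiring_1"
  assumes "m \<le> n"
  shows "(\<Sum>k=m..n. of_nat (k choose m) * (of_nat (n choose k) * a ^ k * b ^ (n - k)))
    = of_nat (n choose m) * a ^ m * (a + b) ^ (n - m)"
proof -
  have "(\<Sum>k=m..n. of_nat (k choose m) * (of_nat (n choose k) * a ^ k * b ^ (n - k)))
      = (\<Sum>k=m..n. of_nat (n choose m) * a ^ m
          * (of_nat (n - m choose (k - m)) * a ^ (k - m) * b ^ (n - m - (k - m))))"
  proof (intro sum.cong refl)
    fix k assume "k \<in> {m..n}"
    then have k: "m \<le> k" "k \<le> n" by auto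
    have choose: "of_nat (n choose k) * of_nat (k choose m)
        = (of_nat (n choose m) * of_nat (n - m choose (k - m)) :: 'a)"
      using choose_mult[OF k] by (simp flip: of_nat_mult)
    have "a ^ k = a ^ m * a ^ (k - m)" "n - k = n - m - (k - m)"
      using k by (simp_all flip: power_add)
    then have "of_nat (k choose m) * (of_nat (n choose k) * a ^ k * b ^ (n - k))
        = (of_nat (n choose k) * of_nat (k choose m))
          * (a ^ m * a ^ (k - m)) * b ^ (n - m - (k - m))"
      by (simp only: mult_ac)
    then show "of_nat (k choose m) * (of_nat (n choose k) * a ^ k * b ^ (n - k))
        = of_nat (n choose m) * a ^ m
          * (of_nat (n - m choose (k - m)) * a ^ (k - m) * b ^ (n - m - (k - m)))"
      unfolding choose by (simp only: mult_ac)
  qed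
  also have "\<dots> = (\<Sum>k=0..n-m. of_nat (n choose m) * a ^ m
          * (of_nat (n - m choose k) * a ^ k * b ^ (n - m - k)))"
    by (rule sum.reindex_bij_witness[of _ "\<lambda>k. k + m" "\<lambda>k. k - m"]) (use assms in auto)
  also have "\<dots> = of_nat (n choose m) * a ^ m * (a + b) ^ (n - m)"
    by (simp add: binomial_ring sum_distrib_left atLeast0AtMost)
  finally show ?thesis .
qed

theorem theorem2p14:
  fixes q :: real and w m :: nat and n :: "nat \<Rightarrow> nat" and x :: "nat \<Rightarrow> real"
  assumes "0 < q" and "q < 1" and "w \<ge> 1"
    and "\<And>i. i \<in> {1..w} \<Longrightarrow> n i \<ge> m"
    and "\<And>i. i \<in> {1..w} \<Longrightarrow> x i \<in> {0..1}"
  shows "(\<Prod>i=1..w. 1 / (qnum q (1 - x i) + qnum q (x i)) ^ (n i - m)) *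
      (\<Sum>k \<in> (\<Pi>\<^sub>E i\<in>{1..w}. {m..n i}).
         (\<Prod>i=1..w. real (k i choose m) / real (n i choose m)) * qbernstein w k n x q)
    = (\<Sum>l \<in> (\<Pi>\<^sub>E i\<in>{1..w}. {0..m}).
         q ^ (\<Sum>i=1..w. l i choose 2) *
         (\<Prod>i=1..w. qbinom q (x i) (l i) * qfact q (l i) * qstirling2 m (l i) q))"
    (is "?L = ?R")
proof -
  let ?a = "\<lambda>i. qnum q (x i)" and ?b = "\<lambda>i. qnum q (1 - x i)"
  let ?B = "\<lambda>i k. real (n i choose k) * ?a i ^ k * ?b i ^ (n i - k)"
  have coord: "1 / (?b i + ?a i) ^ (n i - m)
      * (\<Sum>k=m..n i. real (k choose m) / real (n i choose m) * ?B i k) = ?a i ^ m"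
    if i: "i \<in> {1..w}" for i
  proof -
    have x: "0 \<le> x i" "x i \<le> 1" and n: "m \<le> n i"
      using assms(4,5)[OF i] by auto
    \<comment> \<open>Needed to cancel the power of this sum. One summand may vanish: at
      \<open>x i = 0\<close> positivity comes from \<open>qnum q 1\<close>, otherwise from
      \<open>qnum q (x i)\<close>.\<close>
    have "?b i + ?a i > 0"
    proof (cases "x i = 0")
      case True
      then show ?thesis using assms(1,2) qnum_pos[of q 1] by simp
    next
      case False
      then show ?thesis
        using assms(1,2) x qnum_pos[of q "x i"] qnum_nonneg[of q "1 - x i"] by simp
    qed
    moreover have "real (n i choose m) > 0"
      using n by simp
    moreover have "(\<Sum>k=m..n i. real (k choose m) / real (n i choose m) * ?B i k)
        = (\<Sum>k=m..n i. real (k choose m) * ?B i k) / real (n i choose m)"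
      by (simp add: sum_divide_distrib)
    moreover have "\<dots> = real (n i choose m) * ?a i ^ m * (?a i + ?b i) ^ (n i - m)
        / real (n i choose m)"
      using binomial_sum_choose[OF n, of "?a i" "?b i"] by simp
    ultimately show ?thesis by (simp add: add.commute)
  qed
  have "?L = (\<Prod>i=1..w. 1 / (?b i + ?a i) ^ (n i - m))
      * (\<Sum>k \<in> (\<Pi>\<^sub>E i\<in>{1..w}. {m..n i}).
          \<Prod>i=1..w. real (k i choose m) / real (n i choose m) * ?B i (k i))"
    by (simp only: qbernstein_def prod.distrib)
  \<comment> \<open>Distributivity read backwards: a sum over extensional multi-indices of a product
    over coordinates is a product of \<open>w\<close> single sums.\<close>
  also have "\<dots> = (\<Prod>i=1..w. 1 / (?b i + ?a i) ^ (n i - m)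
      * (\<Sum>k=m..n i. real (k choose m) / real (n i choose m) * ?B i k))"
    by (subst prod.distrib, subst prod_sum_PiE) simp_all
  also have "\<dots> = (\<Prod>i=1..w. ?a i ^ m)"
    by (rule prod.cong[OF refl coord])
  also have "\<dots> = (\<Prod>i=1..w. \<Sum>l=0..m. q ^ (l choose 2)
      * (qbinom q (x i) l * qfact q l * qstirling2 m l q))"
    by (simp only: qnum_power_eq_sum_qstirling2[OF assms(1,2)] atLeast0AtMost)
  also have "\<dots> = ?R"
    by (subst prod_sum_PiE) (simp_all add: prod.distrib power_sum)
  finally show ?thesis .
qed

end
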